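(* Let $\lambda>0$, let $M^*$ be an optimal solution of $$\min_{M\in\mathbb{R}^{d\times d}} f(M)=\frac1T\sum_{t=1}^T \ell\big(\langle A^t,M\rangle\big)\quad\text{s.t. } M\in\mathcal{D}_\lambda,$$ and let $L=\frac1T\sum_{t=1}^T\|A^t\|_F^2$, where $A^t$, $\ell$, $\mathcal{D}_\lambda$ are as defined in the context. At any iteration $k\ge 1$ of the Frank-Wolfe algorithm with away steps described in the context, the iterate $M^{(k)}\in\mathcal{D}_\lambda$ satisfies $$f(M^{(k)})-f(M^* )\le \frac{16L\lambda^2}{k+2}.$$ Furthermore, $M^{(k)}$ has rank at most $k+1$, has at most $4(k+1)$ nonzero entries, and uses at most $2(k+1)$ distinct features.
   Context: Notation: $\langle\cdot,\cdot\rangle$ is the Frobenius inner product and $\|\cdot\|_F$ the Frobenius norm on $\mathbb{R}^{d\times d}$; $e_1,\dots,e_d$ is the canonical basis of $\mathbb{R}^d$; $\mathrm{conv}$ is the convex hull. Feasible domain. For $\lambda>0$ and $i,j\in\{1,\dots,d\}$, $i\ne j$, let $P_\lambda^{(ij)}=\lambda(e_i+e_j)(e_i+e_j)^T$ and $N_\lambda^{(ij)}=\lambda(e_i-e_j)(e_i-e_j)^T$. Let $\mathcal{B}_\lambda=\bigcup_{i\neq j}\{P_\lambda^{(ij)},N_\lambda^{(ij)}\}$ and $\mathcal{D}_\lambda=\mathrm{conv}(\mathcal{B}_\lambda)$. Objective. Given data triplets $(x_t,y_t,z_t)$, $t=1,\dots,T$, of points of $\mathbb{R}^d$, let $A^t=x_t(y_t-z_t)^T\in\mathbb{R}^{d\times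 d}$. The smoothed hinge loss $\ell:\mathbb{R}\to\mathbb{R}^+$ is $\ell(u)=0$ if $u\ge1$, $\ell(u)=\frac12-u$ if $u\le0$, and $\ell(u)=\frac12(1-u)^2$ otherwise. Algorithm (Frank-Wolfe with away steps). Every iterate is maintained as an explicit convex combination $M^{(k)}=\sum_{B\in\mathcal{B}_\lambda}\alpha^{(k)}_B B$ with $\alpha_B^{(k)}\ge0$, $\sum_B\alpha_B^{(k)}=1$, and $\mathcal{S}^{(k)}=\{B\in\mathcal{B}_\lambda:\alpha_B^{(k)}>0\}$ is the set of active basis elements. Initialize $M^{(0)}$ to an arbitrary $B\in\mathcal{B}_\lambda$ (with weight 1). For $k=0,1,2,\dots$: (1) Let $B_F^{(k)}\in\arg\min_{B\in\mathcal{B}_\lambda}\langle B,\nabla f(M^{(k)})\rangle$ and $D_F^{(k)}=B_F^{(k)}-M^{(k)}$ (forward direction). (2) Let $B_A^{(k)}\in\arg\max_{B\in\mathcal{S}^{(k)}}\langle B,\nabla f(M^{(k)})\rangle$ and $D_A^{(k)}=M^{(k)}-B_A^{(k)}$ (away direction). (3) If $\langle D_F^{(k)},\nabla f(M^{(k)})\rangle\le\langle D_A^{(k)},\nabla f(M^{(k)})\rangle$, set $D^{(k)}=D_F^{(k)}$ and $\gamma_{\max}=1$; otherwise set $D^{(k)}=D_A^{(k)}$ and $\gamma_{\max}=\alpha^{(k)}_{B_A^{(k)}}/(1-\alpha^{(k)}_{B_A^{(k)}})$. (4) Let $\gamma^{(k)}\in\arg\min_{\gamma\in[0,\gamma_{\max}]}f(M^{(k)}+\gamma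 D^{(k)})$ and set $M^{(k+1)}=M^{(k)}+\gamma^{(k)}D^{(k)}$, with the weights $\alpha$ updated accordingly (in a forward step all weights are multiplied by $1-\gamma^{(k)}$ and $\gamma^{(k)}$ is added to the weight of $B_F^{(k)}$; in an away step all weights are multiplied by $1+\gamma^{(k)}$ and $\gamma^{(k)}$ is subtracted from the weight of $B_A^{(k)}$). A matrix $M$ "uses" feature $i\in\{1,\dots,d\}$ if the $i$-th row or $i$-th column of $M$ is nonzero. *)

theory Defs
  imports "HOL-Analysis.Analysis"
begin

text \<open>On \<^typ>\<open>real^'d^'d\<close> the library's inner product and norm, inherited row-wise from
  \<^typ>\<open>real^'d\<close>, are the Frobenius ones.\<close>

lemma inner_matrix_Frobenius:
  fixes A B :: "real^'d^'d"
  shows "A \<bullet> B = (\<Sum>i\<in>UNIV. \<Sum>j\<in>UNIV. A $ i $ j * B $ i $ j)"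
  by (simp add: inner_vec_def)

lemma norm_matrix_Frobenius:
  fixes A :: "real^'d^'d"
  shows "norm A = sqrt (\<Sum>i\<in>UNIV. \<Sum>j\<in>UNIV. (A $ i $ j)\<^sup>2)"
  by (simp add: norm_eq_sqrt_inner inner_matrix_Frobenius power2_eq_square)

definition outer :: "real^'d \<Rightarrow> real^'d \<Rightarrow> real^'d^'d" where
  "outer u v = (\<chi> i j. u $ i * v $ j)"

definition P_mat :: "real \<Rightarrow> 'd::finite \<Rightarrow> 'd \<Rightarrow> real^'d^'d" where
  "P_mat lam i j = lam *\<^sub>R outer (axis i 1 + axis j 1) (axis i 1 + axis j 1)"

definition N_mat :: "real \<Rightarrow> 'd::finite \<Rightarrow> 'd \<Rightarrow> real^'d^'d" where
  "N_mat lam i j = lam *\<^sub>R outer (axis i 1 - axis j 1) (axis i 1 - axis j 1)"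

definition basis_set :: "real \<Rightarrow> (real^'d^'d) set" where
  "basis_set lam = (\<Union>(i, j)\<in>{(i, j). i \<noteq> j}. {P_mat lam i j, N_mat lam i j})"

definition feasible :: "real \<Rightarrow> (real^'d^'d) set" where
  "feasible lam = convex hull (basis_set lam)"

definition smoothed_hinge :: "real \<Rightarrow> real" where
  "smoothed_hinge u = (if u \<ge> 1 then 0 else if u \<le> 0 then 1/2 - u else 1/2 * (1 - u)\<^sup>2)"

definition triplet_mat ::
    "(nat \<Rightarrow> real^'d) \<Rightarrow> (nat \<Rightarrow> real^'d) \<Rightarrow> (nat \<Rightarrow> real^'d) \<Rightarrow> nat \<Rightarrow> real^'d^'d" where
  "triplet_mat x y z t = outer (x t) (y t - z t)"

definition objective ::
    "(nat \<Rightarrow> real^'d) \<Rightarrow> (nat \<Rightarrow> real^'d) \<Rightarrow> (nat \<Rightarrow> real^'d) \<Rightarrow> nat \<Rightarrow> real^'d^'d \<Rightarrow> real" where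
  "objective x y z T M = 1 / real T * (\<Sum>t=1..T. smoothed_hinge (triplet_mat x y z t \<bullet> M))"

definition L_const ::
    "(nat \<Rightarrow> real^'d) \<Rightarrow> (nat \<Rightarrow> real^'d) \<Rightarrow> (nat \<Rightarrow> real^'d) \<Rightarrow> nat \<Rightarrow> real" where
  "L_const x y z T = 1 / real T * (\<Sum>t=1..T. (norm (triplet_mat x y z t))\<^sup>2)"

definition gradient :: "('a::real_inner \<Rightarrow> real) \<Rightarrow> 'a \<Rightarrow> 'a" where
  "gradient f M = (THE G. GDERIV f M :> G)"

definition active_set :: "real \<Rightarrow> (real^'d^'d \<Rightarrow> real) \<Rightarrow> (real^'d^'d) set" where
  "active_set lam \<alpha> = {B \<in> basis_set lam. \<alpha> B > 0}"

text \<open>One iteration, as a relation between the current iterate \<open>M\<close> with weights \<open>\<alpha>\<close> and the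
  next iterate \<open>M'\<close> with weights \<open>\<alpha>'\<close>; it is a relation because none of the minimizers and
  maximizers need be unique. If \<open>\<alpha> BA = 1\<close> then \<open>M = BA\<close>, the away direction is zero and the
  forward branch is taken, so the division by zero in the away branch never matters.\<close>

definition afw_step ::
    "real \<Rightarrow> (real^'d^'d \<Rightarrow> real) \<Rightarrow> real^'d^'d \<Rightarrow> (real^'d^'d \<Rightarrow> real)
      \<Rightarrow> real^'d^'d \<Rightarrow> (real^'d^'d \<Rightarrow> real) \<Rightarrow> bool" where
  "afw_step lam f M \<alpha> M' \<alpha>' \<longleftrightarrow>
    (\<exists>BF BA \<gamma>.
      is_arg_min (\<lambda>B. B \<bullet> gradient f M) (\<lambda>B. B \<in> basis_set lam) BF \<and>
      is_arg_max (\<lambda>B. B \<bullet> gradient f M) (\<lambda>B. B \<in> active_set lam \<alpha>) BA \<and>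
      (let DF = BF - M; DA = M - BA in
        if DF \<bullet> gradient f M \<le> DA \<bullet> gradient f M
        then
          is_arg_min (\<lambda>g. f (M + g *\<^sub>R DF)) (\<lambda>g. g \<in> {0..1}) \<gamma> \<and>
          M' = M + \<gamma> *\<^sub>R DF \<and>
          \<alpha>' = (\<lambda>B. (1 - \<gamma>) * \<alpha> B + (if B = BF then \<gamma> else 0))
        else
          is_arg_min (\<lambda>g. f (M + g *\<^sub>R DA)) (\<lambda>g. g \<in> {0..\<alpha> BA / (1 - \<alpha> BA)}) \<gamma> \<and>
          M' = M + \<gamma> *\<^sub>R DA \<and>
          \<alpha>' = (\<lambda>B. (1 + \<gamma>) * \<alpha> B - (if B = BA then \<gamma> else 0))))"

text \<open>That \<open>\<alpha> k\<close> are convex weights representing \<open>M k\<close> is not assumed: it is an invariant of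
  the updates.\<close>

definition afw_run ::
    "real \<Rightarrow> (real^'d^'d \<Rightarrow> real) \<Rightarrow> (nat \<Rightarrow> real^'d^'d) \<Rightarrow> (nat \<Rightarrow> real^'d^'d \<Rightarrow> real) \<Rightarrow> bool" where
  "afw_run lam f M \<alpha> \<longleftrightarrow>
    (\<exists>B0 \<in> basis_set lam. M 0 = B0 \<and> \<alpha> 0 = (\<lambda>B. if B = B0 then 1 else 0)) \<and>
    (\<forall>k. afw_step lam f (M k) (\<alpha> k) (M (Suc k)) (\<alpha> (Suc k)))"

definition used_features :: "real^'d^'d \<Rightarrow> 'd set" where
  "used_features M = {i. row i M \<noteq> 0 \<or> column i M \<noteq> 0}"

end

theory Submission
  imports Defs
begin

text \<open>Every atom is \<open>lam *\<^sub>R outer w w\<close> with \<open>w \<bullet> w = 2\<close>, and \<open>w w\<^sup>T - I\<close> is a reflection, so the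
  feasible set lies in the spectral ball of radius \<open>lam\<close> around \<open>lam I\<close>. As the data matrices have
  rank one, the curvature of the objective along feasible differences is therefore at most
  \<open>C = 4 L lam\<^sup>2\<close>, half of what the Frobenius diameter gives. A step that is not cut off at the
  maximal away step size satisfies the usual Frank--Wolfe recursion, so \<open>m\<close> such steps give a gap
  of at most \<open>2 C / (m + 2)\<close>. A cut-off step does not increase the objective and removes an active
  atom, while every other step adds at most one; hence at least half of the steps are of the good
  kind, and the factor saved in the curvature compensates for the rest.\<close>

section \<open>The smoothed hinge loss and its gradient\<close>

definition smoothed_hinge_deriv :: "real \<Rightarrow> real" where
  "smoothed_hinge_deriv u = - max 0 (min 1 (1 - u))"

text \<open>Over \<open>a\<close> in the unit interval, \<open>a (1 - u) - a^2 / 2\<close> is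
  maximal at the projection of \<open>1 - u\<close>, so this is the loss in conjugate form. The two
  bounds below then become algebra in \<open>a\<close> and \<open>b\<close>, with no case split over
  the pieces of the loss.\<close>

lemma smoothed_hinge_conjugate:
  fixes u :: real
  defines "a \<equiv> - smoothed_hinge_deriv u"
  shows "smoothed_hinge u = a * (1 - u) - a\<^sup>2 / 2"
  by (auto simp: smoothed_hinge_def smoothed_hinge_deriv_def a_def max_def min_def
      power2_eq_square field_simps)

text \<open>\<open>- smoothed_hinge_deriv u\<close> is the projection of \<open>1 - u\<close> to the unit interval; this is the
  variational inequality of the projection.\<close>

lemma smoothed_hinge_deriv_projection:
  fixes u v :: real
  defines "a \<equiv> - smoothed_hinge_deriv u" and "b \<equiv> - smoothed_hinge_deriv v"
  shows "(1 - u - a) * (b - a) \<le> 0"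
  by (auto simp: smoothed_hinge_deriv_def a_def b_def max_def min_def mult_le_0_iff)

lemma smoothed_hinge_lower:
  "smoothed_hinge u + smoothed_hinge_deriv u * (v - u) \<le> smoothed_hinge v"
proof -
  define a b where "a = - smoothed_hinge_deriv u" and "b = - smoothed_hinge_deriv v"
  have "(1 - v - b) * (a - b) \<le> 0"
    using smoothed_hinge_deriv_projection[of v u] by (simp add: a_def b_def)
  \<comment> \<open>The slack of the next inequality is half this square minus the product
    above.\<close>
  moreover have "0 \<le> (a - b)\<^sup>2" by simp
  ultimately have "a * (1 - u) - a\<^sup>2 / 2 + - a * (v - u) \<le> b * (1 - v) - b\<^sup>2 / 2"
    by (simp only: power2_eq_square) (simp add: algebra_simps)
  then show ?thesis
    using smoothed_hinge_conjugate[of u] smoothed_hinge_conjugate[of v] by (simp add: a_def b_def)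
qed

lemma smoothed_hinge_upper:
  "smoothed_hinge v \<le> smoothed_hinge u + smoothed_hinge_deriv u * (v - u) + (v - u)\<^sup>2 / 2"
proof -
  define a b where "a = - smoothed_hinge_deriv u" and "b = - smoothed_hinge_deriv v"
  have "(1 - u - a) * (b - a) \<le> 0"
    using smoothed_hinge_deriv_projection[of u v] by (simp add: a_def b_def)
  \<comment> \<open>Again the slack is half the square minus the product; the square now compares
    the residuals of the two projections.\<close>
  moreover have "0 \<le> ((1 - v - b) - (1 - u - a))\<^sup>2" by simp
  ultimately have "b * (1 - v) - b\<^sup>2 / 2
      \<le> a * (1 - u) - a\<^sup>2 / 2 + - a * (v - u) + (v - u)\<^sup>2 / 2"
    by (simp only: power2_eq_square) (simp add: field_simps)
  then show ?thesis
    using smoothed_hinge_conjugate[of u] smoothed_hinge_conjugate[of v] by (simp add: a_def b_def)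
qed

text \<open>The bounds squeeze the quotient of the remainder between \<open>0\<close> and
  \<open>c * norm (y - x)\<close>. Differentiability thus comes from global inequalities, and the
  piecewise loss is never differentiated.\<close>

lemma quadratic_remainder_imp_GDERIV:
  fixes f :: "'a::real_inner \<Rightarrow> real"
  assumes lower: "\<And>y. f x + G \<bullet> (y - x) \<le> f y"
    and upper: "\<And>y. f y \<le> f x + G \<bullet> (y - x) + c * (norm (y - x))\<^sup>2"
  shows "GDERIV f x :> G"
proof -
  have "((\<lambda>y. (f y - f x - (y - x) \<bullet> G) / norm (y - x)) \<longlongrightarrow> 0) (at x)"
  proof (rule Lim_null_comparison)
    show "\<forall>\<^sub>F y in at x. norm ((f y - f x - (y - x) \<bullet> G) / norm (y - x)) \<le> c * norm (y - x)"
      unfolding eventually_at_filter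
    proof (intro always_eventually allI impI)
      fix y assume "y \<noteq> x"
      then have n: "norm (y - x) > 0" by simp
      have "\<bar>f y - f x - (y - x) \<bullet> G\<bar> \<le> c * norm (y - x) * norm (y - x)"
        using lower[of y] upper[of y] by (simp add: inner_commute power2_eq_square algebra_simps)
      then show "norm ((f y - f x - (y - x) \<bullet> G) / norm (y - x)) \<le> c * norm (y - x)"
        using n by (simp add: pos_divide_le_eq)
    qed
    have "((\<lambda>y. c * norm (y - x)) \<longlongrightarrow> c * norm (x - x)) (at x)"
      by (intro tendsto_intros)
    then show "((\<lambda>y. c * norm (y - x)) \<longlongrightarrow> 0) (at x)" by simp
  qed
  then have "((\<lambda>y. (f y - f x - (y - x) \<bullet> G) /\<^sub>R norm (y - x)) \<longlongrightarrow> 0) (at x)"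
    by (simp add: divide_inverse_commute)
  then show ?thesis
    unfolding gderiv_def has_derivative_at_within
    by (auto intro: bounded_linear_inner_left simp: diff_diff_eq)
qed

lemma gradient_eqI:
  assumes "GDERIV f x :> G"
  shows "gradient f x = G"
  unfolding gradient_def
proof (rule the_equality[where P = "\<lambda>G. GDERIV f x :> G", OF assms])
  fix H assume "GDERIV f x :> H"
  then have "(\<lambda>h. h \<bullet> H) = (\<lambda>h. h \<bullet> G)"
    using assms unfolding gderiv_def by (rule has_derivative_unique)
  then have "(H - G) \<bullet> H = (H - G) \<bullet> G" by metis
  then have "(H - G) \<bullet> (H - G) = 0" by (simp add: inner_diff_right)
  then show "H = G" by simp
qed

definition objective_grad ::
    "(nat \<Rightarrow> real^'d) \<Rightarrow> (nat \<Rightarrow> real^'d) \<Rightarrow> (nat \<Rightarrow> real^'d) \<Rightarrow> nat \<Rightarrow> real^'d^'d \<Rightarrow> real^'d^'d" where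
  "objective_grad x y z T M = (1 / real T) *\<^sub>R
    (\<Sum>t=1..T. smoothed_hinge_deriv (triplet_mat x y z t \<bullet> M) *\<^sub>R triplet_mat x y z t)"

lemma objective_grad_inner:
  "objective_grad x y z T M \<bullet> D = 1 / real T *
    (\<Sum>t=1..T. smoothed_hinge_deriv (triplet_mat x y z t \<bullet> M) * (triplet_mat x y z t \<bullet> D))"
  by (simp add: objective_grad_def inner_sum_left)

lemma objective_lower:
  "objective x y z T M + objective_grad x y z T M \<bullet> (N - M) \<le> objective x y z T N"
proof -
  have "(\<Sum>t=1..T. smoothed_hinge (triplet_mat x y z t \<bullet> M)
          + smoothed_hinge_deriv (triplet_mat x y z t \<bullet> M) * (triplet_mat x y z t \<bullet> (N - M)))
      \<le> (\<Sum>t=1..T. smoothed_hinge (triplet_mat x y z t \<bullet> N))"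
    by (intro sum_mono) (simp add: inner_diff_right smoothed_hinge_lower)
  then show ?thesis
    unfolding objective_def objective_grad_inner distrib_left[symmetric] sum.distrib[symmetric]
    by (intro mult_left_mono) simp_all
qed

text \<open>The quadratic term stays a sum over the triplets, because the rank-one form of each
  \<open>triplet_mat\<close> later gives more than Cauchy-Schwarz in the Frobenius norm.\<close>

lemma objective_upper:
  "objective x y z T N \<le> objective x y z T M + objective_grad x y z T M \<bullet> (N - M)
     + 1 / real T * (\<Sum>t=1..T. (triplet_mat x y z t \<bullet> (N - M))\<^sup>2 / 2)"
proof -
  have "(\<Sum>t=1..T. smoothed_hinge (triplet_mat x y z t \<bullet> N))
      \<le> (\<Sum>t=1..T. smoothed_hinge (triplet_mat x y z t \<bullet> M)
          + smoothed_hinge_deriv (triplet_mat x y z t \<bullet> M) * (triplet_mat x y z t \<bullet> (N - M))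
          + (triplet_mat x y z t \<bullet> (N - M))\<^sup>2 / 2)"
    by (intro sum_mono) (simp add: inner_diff_right smoothed_hinge_upper)
  then show ?thesis
    unfolding objective_def objective_grad_inner distrib_left[symmetric] sum.distrib[symmetric]
    by (intro mult_left_mono) simp_all
qed

lemma gradient_objective: "gradient (objective x y z T) = objective_grad x y z T"
proof
  fix M
  show "gradient (objective x y z T) M = objective_grad x y z T M"
  proof (intro gradient_eqI quadratic_remainder_imp_GDERIV objective_lower)
    fix N
    \<comment> \<open>The Frobenius bound suffices here: any constant yields
      differentiability.\<close>
    have "(triplet_mat x y z t \<bullet> (N - M))\<^sup>2 / 2
        \<le> (norm (triplet_mat x y z t))\<^sup>2 / 2 * (norm (N - M))\<^sup>2" for t
      using power_mono[OF Cauchy_Schwarz_ineq2[of "triplet_mat x y z t" "N - M"], of 2]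
      by (simp add: power_mult_distrib)
    then have "1 / real T * (\<Sum>t=1..T. (triplet_mat x y z t \<bullet> (N - M))\<^sup>2 / 2)
        \<le> 1 / real T * (\<Sum>t=1..T. (norm (triplet_mat x y z t))\<^sup>2 / 2 * (norm (N - M))\<^sup>2)"
      by (intro mult_left_mono sum_mono) simp_all
    also have "\<dots> = L_const x y z T / 2 * (norm (N - M))\<^sup>2"
      by (simp add: L_const_def sum_distrib_right[symmetric] sum_divide_distrib[symmetric])
    finally show "objective x y z T N \<le> objective x y z T M
        + objective_grad x y z T M \<bullet> (N - M) + L_const x y z T / 2 * (norm (N - M))\<^sup>2"
      using objective_upper[of x y z T N M] by linarith
  qed
qed

section \<open>The feasible set\<close>

lemma outer_inner_outer: "outer a b \<bullet> outer u v = (a \<bullet> u) * (b \<bullet> v)"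
  by (simp add: inner_matrix_Frobenius outer_def inner_vec_def sum_product mult_ac)

lemma norm_outer_power2: "(norm (outer a b))\<^sup>2 = (norm a)\<^sup>2 * (norm b)\<^sup>2"
  by (simp add: power2_norm_eq_inner outer_inner_outer)

lemma finite_basis_set [simp]: "finite (basis_set lam)"
  unfolding basis_set_def by (rule finite_UN_I) auto

text \<open>A sign \<open>c\<close> covers both kinds of atoms. The squared length 2 serves the
  curvature bound, the single vector \<open>w\<close> the rank, and the two-point support the counts
  of entries and features.\<close>

lemma basis_setE:
  assumes "B \<in> basis_set lam"
  obtains w p q where "B = lam *\<^sub>R outer w w" "w \<bullet> w = 2" "\<And>i. w $ i \<noteq> 0 \<Longrightarrow> i \<in> {p, q}"
proof -
  from assms obtain p q where pq: "p \<noteq> q" and "B = P_mat lam p q \<or> B = N_mat lam p q"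
    unfolding basis_set_def by auto
  then obtain c :: real where c: "c = 1 \<or> c = - 1"
    and B: "B = lam *\<^sub>R outer (axis p 1 + c *\<^sub>R axis q 1) (axis p 1 + c *\<^sub>R axis q 1)"
    unfolding P_mat_def N_mat_def by (metis diff_conv_add_uminus scaleR_minus1_left scaleR_one)
  let ?w = "axis p 1 + c *\<^sub>R axis q 1 :: real^'a"
  show ?thesis
  proof (rule that[OF B, of p q])
    show "?w \<bullet> ?w = 2"
      using c pq by (auto simp: inner_add_left inner_add_right inner_axis_axis)
    show "i \<in> {p, q}" if "?w $ i \<noteq> 0" for i
      using that by (auto simp: axis_def split: if_splits)
  qed
qed

text \<open>The left side is the bilinear form of \<open>u - lam I\<close> at \<open>a\<close> and
  \<open>b\<close>. On an atom it pairs \<open>a\<close> with a reflected \<open>b\<close>, up to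
  the factor \<open>lam\<close>. The bound describes the preimage of an interval under a linear map,
  so it passes from the atoms to their hull.\<close>

lemma feasible_near_identity:
  assumes "lam \<ge> 0" "u \<in> feasible lam"
  shows "\<bar>outer a b \<bullet> u - lam * (a \<bullet> b)\<bar> \<le> lam * (norm a * norm b)"
proof -
  let ?K = "cball (lam * (a \<bullet> b)) (lam * (norm a * norm b))"
  have "B \<in> (\<lambda>u. outer a b \<bullet> u) -` ?K" if "B \<in> basis_set lam" for B
  proof -
    from that obtain w p q where w: "B = lam *\<^sub>R outer w w" "w \<bullet> w = 2"
      and "\<And>i. w $ i \<noteq> 0 \<Longrightarrow> i \<in> {p, q}" by (rule basis_setE) blast
    \<comment> \<open>By \<open>w \<bullet> w = 2\<close> the two terms in
      \<open>(w \<bullet> b)^2\<close> cancel.\<close>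
    have "(norm ((w \<bullet> b) *\<^sub>R w - b))\<^sup>2 = (norm b)\<^sup>2"
      using w(2) by (simp add: power2_norm_eq_inner inner_diff_left inner_diff_right inner_commute)
    then have n: "norm ((w \<bullet> b) *\<^sub>R w - b) = norm b" by simp
    have "outer a b \<bullet> B - lam * (a \<bullet> b) = lam * (a \<bullet> ((w \<bullet> b) *\<^sub>R w - b))"
      by (simp add: w(1) outer_inner_outer inner_diff_right inner_commute algebra_simps)
    moreover have "\<bar>a \<bullet> ((w \<bullet> b) *\<^sub>R w - b)\<bar> \<le> norm a * norm b"
      using Cauchy_Schwarz_ineq2[of a "(w \<bullet> b) *\<^sub>R w - b"] n by simp
    ultimately have "\<bar>outer a b \<bullet> B - lam * (a \<bullet> b)\<bar> \<le> lam * (norm a * norm b)"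
      using assms(1) by (simp add: abs_mult mult_left_mono)
    then show ?thesis by (simp add: dist_real_def abs_minus_commute)
  qed
  moreover have "convex ((\<lambda>u. outer a b \<bullet> u) -` ?K)"
    by (intro convex_linear_vimage convex_cball bounded_linear.linear bounded_linear_inner_right)
  ultimately have "feasible lam \<subseteq> (\<lambda>u. outer a b \<bullet> u) -` ?K"
    unfolding feasible_def by (intro hull_minimal) auto
  with assms(2) show ?thesis by (auto simp: dist_real_def abs_minus_commute)
qed

text \<open>Two points of a spectral ball of radius \<open>lam\<close> are at most
  \<open>2 * lam\<close> apart, whence \<open>4 * lam^2\<close>. Only the direction is tied to the
  feasible set; \<open>M\<close> and \<open>g\<close> are arbitrary, so steps beyond the away limit
  are covered.\<close>

lemma objective_curvature:
  assumes "lam \<ge> 0" "u \<in> feasible lam" "v \<in> feasible lam"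
  shows "objective x y z T (M + g *\<^sub>R (u - v)) \<le> objective x y z T M
    + g * (objective_grad x y z T M \<bullet> (u - v)) + g\<^sup>2 / 2 * (4 * L_const x y z T * lam\<^sup>2)"
proof -
  have "(triplet_mat x y z t \<bullet> (g *\<^sub>R (u - v)))\<^sup>2 / 2
      \<le> g\<^sup>2 / 2 * (4 * lam\<^sup>2) * (norm (triplet_mat x y z t))\<^sup>2" for t
  proof -
    let ?a = "x t" and ?b = "y t - z t"
    have "\<bar>outer ?a ?b \<bullet> (u - v)\<bar> \<le> 2 * lam * (norm ?a * norm ?b)"
      using feasible_near_identity[OF assms(1,2), of ?a ?b]
        feasible_near_identity[OF assms(1,3), of ?a ?b]
      by (simp only: inner_diff_right)
    from power_mono[OF this, of 2]
    have "(outer ?a ?b \<bullet> (u - v))\<^sup>2 \<le> 4 * lam\<^sup>2 * (norm (outer ?a ?b))\<^sup>2"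
      by (simp add: norm_outer_power2 power_mult_distrib)
    from mult_left_mono[OF this, of "g\<^sup>2 / 2"] show ?thesis
      by (simp add: triplet_mat_def power_mult_distrib mult_ac)
  qed
  then have "1 / real T * (\<Sum>t=1..T. (triplet_mat x y z t \<bullet> (g *\<^sub>R (u - v)))\<^sup>2 / 2)
      \<le> 1 / real T * (\<Sum>t=1..T. g\<^sup>2 / 2 * (4 * lam\<^sup>2) * (norm (triplet_mat x y z t))\<^sup>2)"
    by (intro mult_left_mono sum_mono) simp_all
  also have "\<dots> = g\<^sup>2 / 2 * (4 * L_const x y z T * lam\<^sup>2)"
    by (simp add: L_const_def sum_distrib_left[symmetric])
  finally show ?thesis
    using objective_upper[of x y z T "M + g *\<^sub>R (u - v)" M] by simp
qed

section \<open>The weights\<close>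

text \<open>Summing over all atoms keeps the index set fixed while atoms enter and leave the active
  set.\<close>

definition convex_weights :: "real \<Rightarrow> (real^'d^'d \<Rightarrow> real) \<Rightarrow> real^'d^'d \<Rightarrow> bool" where
  "convex_weights lam \<alpha> M \<longleftrightarrow> (\<forall>B\<in>basis_set lam. 0 \<le> \<alpha> B) \<and> sum \<alpha> (basis_set lam) = 1 \<and>
    (\<Sum>B\<in>basis_set lam. \<alpha> B *\<^sub>R B) = M"

lemma convex_weights_feasible: "convex_weights lam \<alpha> M \<Longrightarrow> M \<in> feasible lam"
  unfolding convex_weights_def feasible_def convex_hull_finite[OF finite_basis_set] by blast

lemma basis_subset_feasible: "basis_set lam \<subseteq> feasible lam"
  unfolding feasible_def by (rule hull_subset)

lemma finite_active_set [simp]: "finite (active_set lam \<alpha>)"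
  unfolding active_set_def by simp

lemma convex_weights_active_sum:
  assumes "convex_weights lam \<alpha> M"
  shows "M = (\<Sum>B\<in>active_set lam \<alpha>. \<alpha> B *\<^sub>R B)"
proof -
  have "(\<Sum>B\<in>basis_set lam. \<alpha> B *\<^sub>R B) = (\<Sum>B\<in>active_set lam \<alpha>. \<alpha> B *\<^sub>R B)"
    using assms unfolding convex_weights_def active_set_def
    by (intro sum.mono_neutral_right) (auto simp: order.order_iff_strict)
  with assms show ?thesis by (simp add: convex_weights_def)
qed

lemma convex_weights_active_nonempty:
  assumes "convex_weights lam \<alpha> M"
  shows "card (active_set lam \<alpha>) \<ge> 1"
proof -
  have "active_set lam \<alpha> \<noteq> {}"
  proof
    assume "active_set lam \<alpha> = {}"
    then have "sum \<alpha> (basis_set lam) \<le> 0"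
      unfolding active_set_def by (intro sum_nonpos) (auto simp: not_less)
    with assms show False by (simp add: convex_weights_def)
  qed
  then show ?thesis by (simp add: Suc_le_eq card_gt_0_iff)
qed

text \<open>Serves both branches: \<open>c\<close> is the step size in a forward step and its
  negative in an away step. In the latter the second condition on \<open>c\<close> is exactly the
  limit on the step size.\<close>

lemma convex_weights_shift:
  assumes w: "convex_weights lam \<alpha> M" and B0: "B0 \<in> basis_set lam"
    and c: "0 \<le> 1 - c" "0 \<le> (1 - c) * \<alpha> B0 + c"
  shows "convex_weights lam (\<lambda>B. (1 - c) * \<alpha> B + (if B = B0 then c else 0)) (M + c *\<^sub>R (B0 - M))"
proof -
  have "0 \<le> (1 - c) * \<alpha> B + (if B = B0 then c else 0)" if "B \<in> basis_set lam" for B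
    using w c that by (auto simp: convex_weights_def)
  moreover have "(\<Sum>B\<in>basis_set lam. (1 - c) * \<alpha> B + (if B = B0 then c else 0)) = 1"
    using w B0 by (simp add: convex_weights_def sum.distrib sum_distrib_left[symmetric])
  moreover have "(\<Sum>B\<in>basis_set lam. ((1 - c) * \<alpha> B + (if B = B0 then c else 0)) *\<^sub>R B)
      = (1 - c) *\<^sub>R (\<Sum>B\<in>basis_set lam. \<alpha> B *\<^sub>R B) + (\<Sum>B\<in>basis_set lam. if B = B0 then c *\<^sub>R B else 0)"
    unfolding scaleR_sum_right sum.distrib[symmetric]
    by (intro sum.cong) (auto simp: algebra_simps)
  ultimately show ?thesis
    using w B0 by (simp add: convex_weights_def algebra_simps)
qed

text \<open>Needed to show that the away atom has weight below 1, so that the maximal away step size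
  is a genuine quotient.\<close>

lemma convex_weights_eq_1:
  assumes w: "convex_weights lam \<alpha> M" and B0: "B0 \<in> basis_set lam"
  shows "\<alpha> B0 \<le> 1" "\<alpha> B0 = 1 \<Longrightarrow> M = B0"
proof -
  have s: "sum \<alpha> (basis_set lam) = \<alpha> B0 + sum \<alpha> (basis_set lam - {B0})"
    using B0 by (simp add: sum.remove)
  have nn: "\<And>B. B \<in> basis_set lam - {B0} \<Longrightarrow> 0 \<le> \<alpha> B" using w by (simp add: convex_weights_def)
  then have "0 \<le> sum \<alpha> (basis_set lam - {B0})" by (rule sum_nonneg)
  with s w show "\<alpha> B0 \<le> 1" by (simp add: convex_weights_def)
  assume 1: "\<alpha> B0 = 1"
  then have "sum \<alpha> (basis_set lam - {B0}) = 0" using s w by (simp add: convex_weights_def)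
  then have z: "\<forall>B\<in>basis_set lam - {B0}. \<alpha> B = 0"
    using nn sum_nonneg_eq_0_iff[of "basis_set lam - {B0}" \<alpha>] by auto
  have "M = \<alpha> B0 *\<^sub>R B0 + (\<Sum>B\<in>basis_set lam - {B0}. \<alpha> B *\<^sub>R B)"
    using w B0 by (simp add: convex_weights_def sum.remove)
  also have "\<dots> = B0" using z 1 by simp
  finally show "M = B0" .
qed

section \<open>One iteration\<close>

text \<open>By convexity, a minimizer short of the right end \<open>b\<close> is a minimizer over
  all nonnegative steps. An away step that is not cut off can therefore be compared with every
  \<open>g\<close> up to 1, even when \<open>b\<close> is smaller.\<close>

lemma line_search_interior:
  fixes f :: "'a::real_inner \<Rightarrow> real"
  assumes lower: "\<And>x y. f x + G x \<bullet> (y - x) \<le> f y"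
    and min: "is_arg_min (\<lambda>g. f (M + g *\<^sub>R D)) (\<lambda>g. g \<in> {0..b}) c" and "c < b" "0 \<le> g"
  shows "f (M + c *\<^sub>R D) \<le> f (M + g *\<^sub>R D)"
proof (cases "g \<le> b")
  case True
  with assms show ?thesis by (auto simp: is_arg_min_linorder)
next
  case False
  \<comment> \<open>The slope at the right end is nonnegative because \<open>c < b\<close> does at
    least as well; beyond \<open>b\<close> the function cannot fall below its value there.\<close>
  let ?s = "G (M + b *\<^sub>R D) \<bullet> D"
  have low: "f (M + b *\<^sub>R D) + (t - b) * ?s \<le> f (M + t *\<^sub>R D)" for t
    using lower[of "M + b *\<^sub>R D" "M + t *\<^sub>R D"]
    by (simp add: scaleR_diff_left[symmetric])
  have cb: "f (M + c *\<^sub>R D) \<le> f (M + b *\<^sub>R D)"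
    using min \<open>c < b\<close> by (auto simp: is_arg_min_linorder)
  then have "(c - b) * ?s \<le> 0" using low[of c] by linarith
  then have "?s \<ge> 0" using \<open>c < b\<close> by (simp add: mult_le_0_iff)
  then have "(g - b) * ?s \<ge> 0" using False by simp
  with low[of g] cb show ?thesis by linarith
qed

text \<open>The forward slope is at most \<open>f X - f M\<close>, and the away branch is taken only
  when its slope is smaller still, so either direction gives the Frank-Wolfe recursion. The second
  alternative is the away step of maximal length.\<close>

lemma afw_step_progress:
  fixes f :: "real^'d^'d \<Rightarrow> real"
  assumes step: "afw_step lam f M \<alpha> M' \<alpha>'" and w: "convex_weights lam \<alpha> M"
    and grad: "gradient f = G"
    and lower: "\<And>x y. f x + G x \<bullet> (y - x) \<le> f y"
    and curv: "\<And>x u v g. u \<in> feasible lam \<Longrightarrow> v \<in> feasible lam \<Longrightarrow>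
      f (x + g *\<^sub>R (u - v)) \<le> f x + g * (G x \<bullet> (u - v)) + g\<^sup>2 / 2 * C"
    and X: "X \<in> feasible lam"
  shows "convex_weights lam \<alpha>' M' \<and>
    (card (active_set lam \<alpha>') \<le> card (active_set lam \<alpha>) + 1 \<and>
       (\<forall>g\<in>{0..1}. f M' - f X \<le> (1 - g) * (f M - f X) + g\<^sup>2 / 2 * C) \<or>
     card (active_set lam \<alpha>') < card (active_set lam \<alpha>) \<and> f M' \<le> f M)"
proof -
  obtain BF BA c where
    F: "is_arg_min (\<lambda>B. B \<bullet> G M) (\<lambda>B. B \<in> basis_set lam) BF" and
    A: "is_arg_max (\<lambda>B. B \<bullet> G M) (\<lambda>B. B \<in> active_set lam \<alpha>) BA" and
    br: "if (BF - M) \<bullet> G M \<le> (M - BA) \<bullet> G M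
        then is_arg_min (\<lambda>g. f (M + g *\<^sub>R (BF - M))) (\<lambda>g. g \<in> {0..1}) c \<and>
          M' = M + c *\<^sub>R (BF - M) \<and> \<alpha>' = (\<lambda>B. (1 - c) * \<alpha> B + (if B = BF then c else 0))
        else is_arg_min (\<lambda>g. f (M + g *\<^sub>R (M - BA))) (\<lambda>g. g \<in> {0..\<alpha> BA / (1 - \<alpha> BA)}) c \<and>
          M' = M + c *\<^sub>R (M - BA) \<and> \<alpha>' = (\<lambda>B. (1 + c) * \<alpha> B - (if B = BA then c else 0))"
    using step unfolding afw_step_def Let_def grad by blast
  have BF: "BF \<in> basis_set lam" and BFmin: "\<And>B. B \<in> basis_set lam \<Longrightarrow> BF \<bullet> G M \<le> B \<bullet> G M"
    using F by (auto simp: is_arg_min_linorder)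
  have BA: "BA \<in> basis_set lam" "\<alpha> BA > 0" using A by (auto simp: is_arg_max_def active_set_def)
  have MF: "M \<in> feasible lam" using w by (rule convex_weights_feasible)
  have BFF: "BF \<in> feasible lam" "BA \<in> feasible lam" using BF BA basis_subset_feasible by auto
  \<comment> \<open>A linear lower bound on the atoms extends to their hull, so \<open>BF\<close> is
    minimal over the whole feasible set.\<close>
  have "convex {u. BF \<bullet> G M \<le> G M \<bullet> u}"
    using convex_halfspace_ge[of "BF \<bullet> G M" "G M"] by simp
  then have "feasible lam \<subseteq> {u. BF \<bullet> G M \<le> G M \<bullet> u}"
    unfolding feasible_def by (intro hull_minimal) (use BFmin in \<open>auto simp: inner_commute\<close>)
  then have BFmin': "BF \<bullet> G M \<le> u \<bullet> G M" if "u \<in> feasible lam" for u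
    using that by (auto simp: inner_commute)
  have gap: "(BF - M) \<bullet> G M \<le> f X - f M"
    using lower[of M X] BFmin'[OF X] by (simp add: inner_commute inner_diff_left inner_diff_right)
  have good: "f M' - f X \<le> (1 - g) * (f M - f X) + g\<^sup>2 / 2 * C"
    if "u \<in> feasible lam" "v \<in> feasible lam" "(u - v) \<bullet> G M \<le> f X - f M"
      "f M' \<le> f (M + g *\<^sub>R (u - v))" "0 \<le> g" for u v g
    using curv[of u v M g] mult_left_mono[OF that(3,5)] that
    by (simp add: inner_commute algebra_simps)
  show ?thesis
  proof (cases "(BF - M) \<bullet> G M \<le> (M - BA) \<bullet> G M")
    case True
    then have min: "is_arg_min (\<lambda>g. f (M + g *\<^sub>R (BF - M))) (\<lambda>g. g \<in> {0..1}) c"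
      and M': "M' = M + c *\<^sub>R (BF - M)"
      and \<alpha>': "\<alpha>' = (\<lambda>B. (1 - c) * \<alpha> B + (if B = BF then c else 0))"
      using br by auto
    have c: "0 \<le> c" "c \<le> 1" using min by (auto simp: is_arg_min_linorder)
    have w': "convex_weights lam \<alpha>' M'"
      unfolding \<alpha>' M' using w BF c by (intro convex_weights_shift) (auto simp: convex_weights_def)
    have "active_set lam \<alpha>' \<subseteq> insert BF (active_set lam \<alpha>)"
      using c unfolding active_set_def \<alpha>' by (auto simp: zero_less_mult_iff)
    then have "card (active_set lam \<alpha>') \<le> card (insert BF (active_set lam \<alpha>))"
      by (intro card_mono) auto
    also have "\<dots> \<le> card (active_set lam \<alpha>) + 1" by (simp add: card_insert_if)
    finally have "card (active_set lam \<alpha>') \<le> card (active_set lam \<alpha>) + 1" .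
    moreover have "f M' - f X \<le> (1 - g) * (f M - f X) + g\<^sup>2 / 2 * C" if "g \<in> {0..1}" for g
      using that min gap by (intro good[OF BFF(1) MF]) (auto simp: M' is_arg_min_linorder)
    ultimately show ?thesis using w' by blast
  next
    case False
    let ?b = "\<alpha> BA / (1 - \<alpha> BA)"
    from False have min: "is_arg_min (\<lambda>g. f (M + g *\<^sub>R (M - BA))) (\<lambda>g. g \<in> {0..?b}) c"
      and M': "M' = M + c *\<^sub>R (M - BA)"
      and \<alpha>': "\<alpha>' = (\<lambda>B. (1 + c) * \<alpha> B - (if B = BA then c else 0))"
      using br by auto
    have c: "0 \<le> c" "c \<le> ?b" using min by (auto simp: is_arg_min_linorder)
    \<comment> \<open>Weight 1 would make the away direction zero, and the forward slope, being at
      most 0, would have won.\<close>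
    have "\<alpha> BA \<noteq> 1"
      using False BFmin'[OF MF] convex_weights_eq_1(2)[OF w BA(1)] by (auto simp: inner_diff_left)
    then have lt1: "\<alpha> BA < 1" using convex_weights_eq_1(1)[OF w BA(1)] by simp
    have neg: "\<alpha>' = (\<lambda>B. (1 - - c) * \<alpha> B + (if B = BA then - c else 0))"
      "M' = M + (- c) *\<^sub>R (BA - M)"
      unfolding \<alpha>' M' by (auto simp: algebra_simps)
    have w': "convex_weights lam \<alpha>' M'"
      unfolding neg using w BA(1) c lt1 by (intro convex_weights_shift) (auto simp: field_simps)
    \<comment> \<open>Rescaling keeps zero weights at zero, and only the weight of an active atom is
      lowered.\<close>
    have sub: "active_set lam \<alpha>' \<subseteq> active_set lam \<alpha>"
      using c BA unfolding active_set_def \<alpha>' by (auto simp: zero_less_mult_iff)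
    show ?thesis
    proof (cases "c < ?b")
      case True
      have "card (active_set lam \<alpha>') \<le> card (active_set lam \<alpha>)"
        using sub by (intro card_mono) auto
      moreover have "f M' - f X \<le> (1 - g) * (f M - f X) + g\<^sup>2 / 2 * C" if "g \<in> {0..1}" for g
        using that gap False line_search_interior[OF lower min True]
        by (intro good[OF MF BFF(2)]) (auto simp: M')
      ultimately show ?thesis using w' by auto
    next
      case notlt: False
      with c have "c = ?b" by simp
      then have "\<alpha>' BA = 0" using lt1 by (simp add: \<alpha>' field_simps)
      then have "BA \<in> active_set lam \<alpha> - active_set lam \<alpha>'"
        using BA by (simp add: active_set_def)
      with sub have "active_set lam \<alpha>' \<subset> active_set lam \<alpha>" by blast
      then have "card (active_set lam \<alpha>') < card (active_set lam \<alpha>)"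
        by (intro psubset_card_mono) auto
      \<comment> \<open>The zero step is a candidate of the line search.\<close>
      moreover have "f M' \<le> f (M + 0 *\<^sub>R (M - BA))"
        using min c unfolding M' is_arg_min_linorder by (meson atLeastAtMost_iff order.refl order.trans)
      ultimately show ?thesis using w' by simp
    qed
  qed
qed

section \<open>The run\<close>

text \<open>Here \<open>m\<close> counts the steps that were not cut off; the gap of the initial atom is not controlled.\<close>

lemma afw_run_invariant:
  fixes f :: "real^'d^'d \<Rightarrow> real"
  assumes run: "afw_run lam f M \<alpha>"
    and grad: "gradient f = G"
    and lower: "\<And>x y. f x + G x \<bullet> (y - x) \<le> f y"
    and curv: "\<And>x u v g. u \<in> feasible lam \<Longrightarrow> v \<in> feasible lam \<Longrightarrow>
      f (x + g *\<^sub>R (u - v)) \<le> f x + g * (G x \<bullet> (u - v)) + g\<^sup>2 / 2 * C"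
    and X: "X \<in> feasible lam" and C: "0 \<le> C"
  shows "convex_weights lam (\<alpha> k) (M k) \<and> card (active_set lam (\<alpha> k)) \<le> k + 1 \<and>
    (\<exists>m. card (active_set lam (\<alpha> k)) + k \<le> 1 + 2 * m \<and>
      (m \<ge> 1 \<longrightarrow> f (M k) - f X \<le> 2 * C / (real m + 2)))"
proof (induction k)
  case 0
  from run obtain B0 where B0: "B0 \<in> basis_set lam" "M 0 = B0" "\<alpha> 0 = (\<lambda>B. if B = B0 then 1 else 0)"
    unfolding afw_run_def by blast
  have "(\<Sum>B\<in>basis_set lam. \<alpha> 0 B *\<^sub>R B) = (\<Sum>B\<in>basis_set lam. if B = B0 then B else 0)"
    unfolding B0(3) by (intro sum.cong) auto
  then have "convex_weights lam (\<alpha> 0) (M 0)"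
    using B0 by (simp add: convex_weights_def)
  moreover have "active_set lam (\<alpha> 0) = {B0}" using B0 by (auto simp: active_set_def)
  ultimately show ?case by (auto intro: exI[of _ 0])
next
  case (Suc k)
  then obtain m where w: "convex_weights lam (\<alpha> k) (M k)"
    and s: "card (active_set lam (\<alpha> k)) \<le> k + 1"
    and m: "card (active_set lam (\<alpha> k)) + k \<le> 1 + 2 * m"
    and h: "m \<ge> 1 \<Longrightarrow> f (M k) - f X \<le> 2 * C / (real m + 2)" by blast
  have "afw_step lam f (M k) (\<alpha> k) (M (Suc k)) (\<alpha> (Suc k))"
    using run by (simp add: afw_run_def)
  note step = afw_step_progress[OF this w grad lower curv X]
  then have w': "convex_weights lam (\<alpha> (Suc k)) (M (Suc k))" by blast
  \<comment> \<open>The potential \<open>card + k\<close> grows by at most 2 in a good step, matched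
    by raising \<open>m\<close> by one. In a drop step the lost atom pays for the increase of
    \<open>k\<close>, and \<open>m\<close> stays.\<close>
  from step consider
    (good) "card (active_set lam (\<alpha> (Suc k))) \<le> card (active_set lam (\<alpha> k)) + 1"
      "\<And>g. g \<in> {0..1} \<Longrightarrow> f (M (Suc k)) - f X \<le> (1 - g) * (f (M k) - f X) + g\<^sup>2 / 2 * C"
    | (drop) "card (active_set lam (\<alpha> (Suc k))) < card (active_set lam (\<alpha> k))"
      "f (M (Suc k)) \<le> f (M k)" by blast
  then show ?case
  proof cases
    case good
    have "f (M (Suc k)) - f X \<le> 2 * C / (real (Suc m) + 2)"
    proof (cases "m = 0")
      case True
      \<comment> \<open>Taking \<open>g = 1\<close> removes the unknown initial gap, and
        \<open>C / 2\<close> is below the required \<open>2 * C / 3\<close>.\<close>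
      have "f (M (Suc k)) - f X \<le> C / 2" using good(2)[of 1] by simp
      with True C show ?thesis by simp
    next
      case False
      let ?r = "real m + 2"
      \<comment> \<open>The classical step size \<open>2 / (m + 2)\<close>, counted in good steps;
        the induction closes by \<open>(r - 1) (r + 1) \<le> r^2\<close>.\<close>
      have "f (M (Suc k)) - f X \<le> (1 - 2 / ?r) * (f (M k) - f X) + (2 / ?r)\<^sup>2 / 2 * C"
        by (rule good(2)) (simp add: field_simps)
      also have "\<dots> \<le> (1 - 2 / ?r) * (2 * C / ?r) + (2 / ?r)\<^sup>2 / 2 * C"
        using h False by (intro add_right_mono mult_left_mono) (auto simp: field_simps)
      also have "\<dots> = 2 * C * ((?r - 1) / ?r\<^sup>2)"
        by (simp add: power2_eq_square divide_simps) (simp add: algebra_simps)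
      also have "\<dots> \<le> 2 * C * (1 / (?r + 1))"
      proof (intro mult_left_mono)
        have "(?r - 1) * (?r + 1) \<le> 1 * ?r\<^sup>2" by (simp add: power2_eq_square algebra_simps)
        then show "(?r - 1) / ?r\<^sup>2 \<le> 1 / (?r + 1)" 
          by (intro mult_imp_div_pos_le) (simp_all add: pos_le_divide_eq)
      qed (use C in simp)
      finally show ?thesis by (simp add: add_ac)
    qed
    then show ?thesis
      using w' s m good(1) by (intro conjI exI[of _ "Suc m"]) auto
  next
    case drop
    then show ?thesis
      using w' s m h by (intro conjI exI[of _ m]) auto
  qed
qed

section \<open>Sparsity\<close>

text \<open>Each atom maps into a line, so the range of \<open>M\<close> lies in the span of one
  vector per active atom.\<close>

lemma rank_le_card_active:
  assumes "convex_weights lam \<alpha> M"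
  shows "rank M \<le> card (active_set lam \<alpha>)"
proof -
  have "\<forall>B\<in>active_set lam \<alpha>. \<exists>w. \<forall>v. B *v v \<in> span {w}"
  proof
    fix B assume "B \<in> active_set lam \<alpha>"
    then have "B \<in> basis_set lam" by (simp add: active_set_def)
    then obtain w where "B = lam *\<^sub>R outer w w" by (rule basis_setE)
    then have "B *v v = (lam * (w \<bullet> v)) *\<^sub>R w" for v
      by (simp add: vec_eq_iff matrix_vector_mult_def outer_def inner_vec_def sum_distrib_left mult_ac)
    then show "\<exists>w. \<forall>v. B *v v \<in> span {w}" by (metis span_base span_scale singletonI)
  qed
  then obtain w where w: "\<And>B v. B \<in> active_set lam \<alpha> \<Longrightarrow> B *v v \<in> span {w B}" by metis
  have "M *v v \<in> span (w ` active_set lam \<alpha>)" for v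
  proof -
    have lin: "linear (\<lambda>A::real^'a^'a. A *v v)"
      by (intro linearI) (simp_all add: matrix_vector_mult_add_rdistrib scaleR_matrix_vector_assoc)
    have "M *v v = (\<Sum>B\<in>active_set lam \<alpha>. \<alpha> B *\<^sub>R (B *v v))"
      unfolding convex_weights_active_sum[OF assms]
      by (simp add: linear_sum[OF lin] scaleR_matrix_vector_assoc)
    moreover have "B *v v \<in> span (w ` active_set lam \<alpha>)" if "B \<in> active_set lam \<alpha>" for B
      using w[OF that] span_mono[of "{w B}" "w ` active_set lam \<alpha>"] that by auto
    ultimately show ?thesis by (simp add: span_sum span_scale)
  qed
  then have "dim (range ((*v) M)) \<le> card (w ` active_set lam \<alpha>)"
    by (intro dim_le_card) auto
  also have "\<dots> \<le> card (active_set lam \<alpha>)" by (intro card_image_le) simp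
  finally show ?thesis by (simp add: rank_dim_range)
qed

text \<open>A nonzero entry of \<open>M\<close> must come from some active atom, whose support is a
  square block \<open>S B \<times> S B\<close> with at most two indices per side. Both counts are
  union bounds over these blocks.\<close>

lemma card_support_le:
  assumes "convex_weights lam \<alpha> M"
  shows "card {(i, j). M $ i $ j \<noteq> 0} \<le> 4 * card (active_set lam \<alpha>)"
    and "card (used_features M) \<le> 2 * card (active_set lam \<alpha>)"
proof -
  let ?A = "active_set lam \<alpha>"
  have "\<forall>B\<in>?A. \<exists>S. card S \<le> 2 \<and> (\<forall>i j. B $ i $ j \<noteq> 0 \<longrightarrow> i \<in> S \<and> j \<in> S)"
  proof
    fix B assume "B \<in> ?A"
    then have "B \<in> basis_set lam" by (simp add: active_set_def)
    then obtain w p q where "B = lam *\<^sub>R outer w w" "\<And>i. w $ i \<noteq> 0 \<Longrightarrow> i \<in> {p, q}"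
      by (rule basis_setE) blast
    then have "\<forall>i j. B $ i $ j \<noteq> 0 \<longrightarrow> i \<in> {p, q} \<and> j \<in> {p, q}"
      by (simp add: outer_def)
    moreover have "card {p, q} \<le> 2" by (simp add: card_insert_if)
    ultimately show "\<exists>S. card S \<le> 2 \<and> (\<forall>i j. B $ i $ j \<noteq> 0 \<longrightarrow> i \<in> S \<and> j \<in> S)" by blast
  qed
  then obtain S where S: "\<And>B. B \<in> ?A \<Longrightarrow> card (S B) \<le> 2"
    "\<And>B i j. B \<in> ?A \<Longrightarrow> B $ i $ j \<noteq> 0 \<Longrightarrow> i \<in> S B \<and> j \<in> S B" by metis
  have nz: "\<exists>B\<in>?A. i \<in> S B \<and> j \<in> S B" if "M $ i $ j \<noteq> 0" for i j
  proof (rule ccontr)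
    assume "\<not> ?thesis"
    then have "\<And>B. B \<in> ?A \<Longrightarrow> B $ i $ j = 0" using S(2) by blast
    then have "(\<Sum>B\<in>?A. \<alpha> B *\<^sub>R B) $ i $ j = 0" by simp
    with that convex_weights_active_sum[OF assms] show False by simp
  qed
  have "card {(i, j). M $ i $ j \<noteq> 0} \<le> card (\<Union>B\<in>?A. S B \<times> S B)"
    using nz by (intro card_mono) auto
  also have "\<dots> \<le> (\<Sum>B\<in>?A. card (S B \<times> S B))" by (intro card_UN_le) simp
  also have "\<dots> \<le> (\<Sum>B\<in>?A. 2 * 2)"
    unfolding card_cartesian_product using S(1) by (intro sum_mono mult_mono) auto
  finally show "card {(i, j). M $ i $ j \<noteq> 0} \<le> 4 * card ?A" by simp
  have "used_features M \<subseteq> (\<Union>B\<in>?A. S B)"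
  proof
    fix i assume "i \<in> used_features M"
    then obtain j where "M $ i $ j \<noteq> 0 \<or> M $ j $ i \<noteq> 0"
      unfolding used_features_def by (auto simp: vec_eq_iff row_def column_def)
    then show "i \<in> (\<Union>B\<in>?A. S B)" using nz by blast
  qed
  then have "card (used_features M) \<le> card (\<Union>B\<in>?A. S B)" by (intro card_mono) auto
  also have "\<dots> \<le> (\<Sum>B\<in>?A. card (S B))" by (intro card_UN_le) simp
  also have "\<dots> \<le> (\<Sum>B\<in>?A. 2)" using S(1) by (intro sum_mono)
  finally show "card (used_features M) \<le> 2 * card ?A" by simp
qed

theorem proposition1:
  fixes x y z :: "nat \<Rightarrow> real^'d" and T k :: nat and lam :: real
    and Mstar :: "real^'d^'d" and M :: "nat \<Rightarrow> real^'d^'d" and \<alpha> :: "nat \<Rightarrow> real^'d^'d \<Rightarrow> real"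
  assumes "lam > 0" and "T \<ge> 1"
    and "is_arg_min (objective x y z T) (\<lambda>M. M \<in> feasible lam) Mstar"
    and "afw_run lam (objective x y z T) M \<alpha>"
    and "k \<ge> 1"
  shows "M k \<in> feasible lam
    \<and> objective x y z T (M k) - objective x y z T Mstar
        \<le> 16 * L_const x y z T * lam\<^sup>2 / (real k + 2)
    \<and> rank (M k) \<le> k + 1
    \<and> card {(i, j). M k $ i $ j \<noteq> 0} \<le> 4 * (k + 1)
    \<and> card (used_features (M k)) \<le> 2 * (k + 1)"
proof -
  let ?f = "objective x y z T" and ?C = "4 * L_const x y z T * lam\<^sup>2"
  have C: "0 \<le> ?C" by (simp add: L_const_def sum_nonneg)
  have X: "Mstar \<in> feasible lam" using assms(3) by (simp add: is_arg_min_def)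
  have curv: "?f (N + g *\<^sub>R (u - v)) \<le> ?f N + g * (objective_grad x y z T N \<bullet> (u - v)) + g\<^sup>2 / 2 * ?C"
    if "u \<in> feasible lam" "v \<in> feasible lam" for N u v g
    using assms(1) that by (intro objective_curvature) auto
  have "convex_weights lam (\<alpha> k) (M k) \<and> card (active_set lam (\<alpha> k)) \<le> k + 1 \<and>
    (\<exists>m. card (active_set lam (\<alpha> k)) + k \<le> 1 + 2 * m \<and>
      (m \<ge> 1 \<longrightarrow> ?f (M k) - ?f Mstar \<le> 2 * ?C / (real m + 2)))"
    by (rule afw_run_invariant[OF assms(4) gradient_objective objective_lower curv X C])
  then obtain m where w: "convex_weights lam (\<alpha> k) (M k)"
    and s: "card (active_set lam (\<alpha> k)) \<le> k + 1"
    and m: "card (active_set lam (\<alpha> k)) + k \<le> 1 + 2 * m"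
    and h: "m \<ge> 1 \<Longrightarrow> ?f (M k) - ?f Mstar \<le> 2 * ?C / (real m + 2)" by blast
  \<comment> \<open>At least one atom stays active, which absorbs the 1 in the invariant; with
    \<open>k \<ge> 1\<close> this forces \<open>m \<ge> 1\<close>.\<close>
  have km: "k \<le> 2 * m" using m convex_weights_active_nonempty[OF w] by linarith
  with \<open>k \<ge> 1\<close> h have "?f (M k) - ?f Mstar \<le> 2 * ?C / (real m + 2)" by simp
  \<comment> \<open>Since \<open>m \<ge> k / 2\<close>, also \<open>m + 2 \<ge> (k + 2) / 2\<close>;
    halving the denominator turns \<open>2 * ?C\<close> into \<open>4 * ?C\<close>, which is the
    constant 16.\<close>
  also have "\<dots> \<le> 2 * ?C / ((real k + 2) / 2)"
    using C km by (intro divide_left_mono) auto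
  also have "\<dots> = 16 * L_const x y z T * lam\<^sup>2 / (real k + 2)" by simp
  finally have gap: "?f (M k) - ?f Mstar \<le> 16 * L_const x y z T * lam\<^sup>2 / (real k + 2)" .
  show ?thesis
  proof (intro conjI)
    show "rank (M k) \<le> k + 1"
      using rank_le_card_active[OF w] s by (rule order.trans)
    show "card {(i, j). M k $ i $ j \<noteq> 0} \<le> 4 * (k + 1)"
      using card_support_le(1)[OF w] mult_le_mono2[OF s] by (rule order.trans)
    show "card (used_features (M k)) \<le> 2 * (k + 1)"
      using card_support_le(2)[OF w] mult_le_mono2[OF s] by (rule order.trans)
  qed (fact convex_weights_feasible[OF w], fact gap)
qed

end
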